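(* Let $\mathcal H$ be a Hilbert space and let $(x_n)_{n\geq 1}$ be a Bessel sequence of unit vectors in $\mathcal H$. Then $(x_n)_{n\geq 1}$ can be partitioned into finitely many separated Bessel sequences.
   Context: Hilbert spaces are complex. A (finite or countable) family $(x_n)_{n\in I}$ in a Hilbert space $\mathcal H$ is a Bessel sequence if there is a constant $B>0$ such that $\big\| \sum_{n\in I} a_n x_n\big\|^2\leq B\sum_{n\in I} |a_n|^2$ for all finitely supported families $(a_n)_{n\in I}$ of complex numbers. A family of unit vectors $(x_n)_{n\in I}$ is separated if there is a constant $\gamma<1$ such that $|\langle x_n,x_k\rangle|\le\gamma$ for all $n,k\in I$ with $n\ne k$. "$(x_n)_{n\ge1}$ can be partitioned into finitely many separated Bessel sequences" means that the index set $\{1,2,3,\dots\}$ is a union of finitely many pairwise disjoint subsets $I_1,\dots,I_r$ such that each subfamily $(x_n)_{n\in I_j}$ is a separated Bessel sequence (the $I_j$ may be finite or infinite). *)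

theory Defs
  imports "HOL-Analysis.Analysis"
begin

text \<open>
  Complex Hilbert spaces. The real scalar multiplication required by the superclass is the
  restriction of the complex one. The inner product is linear in its first argument.
\<close>

class complex_inner = real_normed_vector +
  fixes scaleC :: "complex \<Rightarrow> 'a \<Rightarrow> 'a"  (infixr \<open>*\<^sub>C\<close> 75)
    and cinner :: "'a \<Rightarrow> 'a \<Rightarrow> complex"
  assumes scaleR_scaleC: "scaleR r x = complex_of_real r *\<^sub>C x"
    and scaleC_add_right: "c *\<^sub>C (x + y) = c *\<^sub>C x + c *\<^sub>C y"
    and scaleC_add_left: "(c + d) *\<^sub>C x = c *\<^sub>C x + d *\<^sub>C x"
    and scaleC_scaleC: "c *\<^sub>C d *\<^sub>C x = (c * d) *\<^sub>C x"
    and scaleC_one: "1 *\<^sub>C x = x"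
    and cinner_commute: "cinner x y = cnj (cinner y x)"
    and cinner_add_left: "cinner (x + y) z = cinner x z + cinner y z"
    and cinner_scaleC_left: "cinner (c *\<^sub>C x) y = c * cinner x y"
    and norm_cinner: "complex_of_real ((norm x)\<^sup>2) = cinner x x"

class complex_hilbert = complex_inner + complete_space

instantiation complex :: complex_hilbert
begin

definition "scaleC_complex (c :: complex) (x :: complex) = c * x"
definition "cinner_complex (x :: complex) (y :: complex) = x * cnj y"

instance
proof
  fix x y z c d :: complex and r :: real
  show "r *\<^sub>R x = complex_of_real r *\<^sub>C x"
    by (simp add: scaleC_complex_def scaleR_conv_of_real)
  show "c *\<^sub>C (x + y) = c *\<^sub>C x + c *\<^sub>C y"
    by (simp add: scaleC_complex_def distrib_left)
  show "(c + d) *\<^sub>C x = c *\<^sub>C x + d *\<^sub>C x"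
    by (simp add: scaleC_complex_def distrib_right)
  show "c *\<^sub>C d *\<^sub>C x = (c * d) *\<^sub>C x"
    by (simp add: scaleC_complex_def mult.assoc)
  show "1 *\<^sub>C x = x"
    by (simp add: scaleC_complex_def)
  show "cinner x y = cnj (cinner y x)"
    by (simp add: cinner_complex_def mult.commute)
  show "cinner (x + y) z = cinner x z + cinner y z"
    by (simp add: cinner_complex_def distrib_right)
  show "cinner (c *\<^sub>C x) y = c * cinner x y"
    by (simp add: cinner_complex_def scaleC_complex_def mult.assoc)
  show "complex_of_real ((norm x)\<^sup>2) = cinner x x"
    unfolding cinner_complex_def by (rule complex_norm_square)
qed

end

definition bessel_on :: "nat set \<Rightarrow> (nat \<Rightarrow> 'a::complex_inner) \<Rightarrow> bool" where
  "bessel_on I x \<longleftrightarrow>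
    (\<exists>B>0. \<forall>a :: nat \<Rightarrow> complex. finite {n \<in> I. a n \<noteq> 0} \<longrightarrow>
      (norm (\<Sum>n | n \<in> I \<and> a n \<noteq> 0. a n *\<^sub>C x n))\<^sup>2
        \<le> B * (\<Sum>n | n \<in> I \<and> a n \<noteq> 0. (cmod (a n))\<^sup>2))"

definition separated_on :: "nat set \<Rightarrow> (nat \<Rightarrow> 'a::complex_inner) \<Rightarrow> bool" where
  "separated_on I x \<longleftrightarrow>
    (\<forall>n\<in>I. norm (x n) = 1) \<and>
    (\<exists>\<gamma><1. \<forall>n\<in>I. \<forall>k\<in>I. n \<noteq> k \<longrightarrow> cmod (cinner (x n) (x k)) \<le> \<gamma>)"

end

theory Submission
  imports Defs
begin

text \<open>
  If \<open>B\<close> is a Bessel bound, then every unit vector \<open>y\<close> satisfies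
  \<open>(\<Sum>k. \<bar>\<langle>y, x\<^sub>k\<rangle>\<bar>\<^sup>2) \<le> B\<close>. Hence in the graph joining
  \<open>n\<close> and \<open>k\<close> when \<open>\<bar>\<langle>x\<^sub>n, x\<^sub>k\<rangle>\<bar> > 1/2\<close> all degrees are at most \<open>4 B\<close>,
  so greedy colouring uses finitely many colours. Each colour class is separated with
  \<open>\<gamma> = 1/2\<close>.
\<close>

lemma cinner_zero_left [simp]: "cinner 0 (y::'a::complex_inner) = 0"
  using cinner_add_left[of 0 0 y] by simp

lemma cinner_diff_left:
  "cinner (x - y) (z::'a::complex_inner) = cinner x z - cinner y z"
  using cinner_add_left[of "x - y" y z] by simp

lemma cinner_diff_right:
  "cinner x (y - (z::'a::complex_inner)) = cinner x y - cinner x z"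
  using cinner_commute[of x "y - z"] cinner_commute[of x y] cinner_commute[of x z]
  by (simp add: cinner_diff_left)

lemma cinner_scaleC_right: "cinner x (c *\<^sub>C (y::'a::complex_inner)) = cnj c * cinner x y"
  using cinner_commute[of x "c *\<^sub>C y"] cinner_commute[of x y]
  by (simp add: cinner_scaleC_left)

lemma cinner_sum_left:
  "cinner (\<Sum>k\<in>A. f k) (y::'a::complex_inner) = (\<Sum>k\<in>A. cinner (f k) y)"
  by (induction A rule: infinite_finite_induct) (simp_all add: cinner_add_left)

lemma scaleC_zero_left [simp]: "0 *\<^sub>C (x::'a::complex_inner) = 0"
  using scaleC_add_left[of 0 0 x] by simp

text \<open>Cauchy-Schwarz against a unit vector: subtracting from \<open>f\<close> its projection
  \<open>c *\<^sub>C y\<close> leaves a vector whose squared norm is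
  \<open>(norm f)\<^sup>2 - (cmod c)\<^sup>2\<close>, and this cannot be negative.\<close>

lemma cmod_cinner_le_norm:
  fixes f y :: "'a::complex_inner"
  assumes "norm y = 1"
  shows "cmod (cinner f y) \<le> norm f"
proof -
  define c where "c = cinner f y"
  have yy: "cinner y y = 1"
    using norm_cinner[of y] assms by simp
  have yf: "cinner y f = cnj c"
    using cinner_commute[of y f] by (simp add: c_def)
  have "complex_of_real ((norm (f - c *\<^sub>C y))\<^sup>2) = cinner f f - c * cnj c"
    unfolding norm_cinner
    by (simp add: cinner_diff_left cinner_diff_right cinner_scaleC_left
        cinner_scaleC_right yy yf flip: c_def)
  also have "\<dots> = complex_of_real ((norm f)\<^sup>2 - (cmod c)\<^sup>2)"
    by (simp only: norm_cinner[of f] of_real_diff complex_norm_square)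
  finally have "(norm (f - c *\<^sub>C y))\<^sup>2 = (norm f)\<^sup>2 - (cmod c)\<^sup>2"
    by (simp only: of_real_eq_iff)
  then have "(cmod c)\<^sup>2 \<le> (norm f)\<^sup>2"
    by (metis diff_ge_0_iff_ge zero_le_power2)
  then show ?thesis
    unfolding c_def by (rule power2_le_imp_le) simp
qed

text \<open>Frees the Bessel bound from supports: coefficients can be cut off to 0 outside
  \<open>F\<close>, and indices in \<open>F\<close> with zero coefficient add nothing to either
  sum.\<close>

lemma bessel_onE:
  fixes x :: "nat \<Rightarrow> 'a::complex_inner"
  assumes "bessel_on I x"
  obtains B where "B > 0"
    and "\<And>F a. finite F \<Longrightarrow> F \<subseteq> I \<Longrightarrow>
      (norm (\<Sum>k\<in>F. a k *\<^sub>C x k))\<^sup>2 \<le> B * (\<Sum>k\<in>F. (cmod (a k))\<^sup>2)"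
proof -
  obtain B where "B > 0" and B: "\<And>a. finite {n \<in> I. a n \<noteq> 0} \<Longrightarrow>
      (norm (\<Sum>n | n \<in> I \<and> a n \<noteq> 0. a n *\<^sub>C x n))\<^sup>2
        \<le> B * (\<Sum>n | n \<in> I \<and> a n \<noteq> 0. (cmod (a n))\<^sup>2)"
    using assms unfolding bessel_on_def by blast
  show ?thesis
  proof (rule that[OF \<open>B > 0\<close>])
    fix F :: "nat set" and a :: "nat \<Rightarrow> complex"
    assume F: "finite F" "F \<subseteq> I"
    define b where "b k = (if k \<in> F then a k else 0)" for k
    have supp: "{n \<in> I. b n \<noteq> 0} = {n \<in> F. a n \<noteq> 0}"
      using F by (auto simp: b_def)
    have "(\<Sum>n | n \<in> I \<and> b n \<noteq> 0. b n *\<^sub>C x n) = (\<Sum>k\<in>F. a k *\<^sub>C x k)"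
      unfolding supp by (rule sum.mono_neutral_cong_left) (use F in \<open>auto simp: b_def\<close>)
    moreover have "(\<Sum>n | n \<in> I \<and> b n \<noteq> 0. (cmod (b n))\<^sup>2) = (\<Sum>k\<in>F. (cmod (a k))\<^sup>2)"
      unfolding supp by (rule sum.mono_neutral_cong_left) (use F in \<open>auto simp: b_def\<close>)
    moreover have "finite {n \<in> I. b n \<noteq> 0}"
      unfolding supp using F by simp
    ultimately show "(norm (\<Sum>k\<in>F. a k *\<^sub>C x k))\<^sup>2 \<le> B * (\<Sum>k\<in>F. (cmod (a k))\<^sup>2)"
      using B[of b] by simp
  qed
qed

lemma bessel_on_subset:
  assumes "bessel_on I x" and "J \<subseteq> I"
  shows "bessel_on J x"
proof -
  obtain B where "B > 0" and "\<And>F a. finite F \<Longrightarrow> F \<subseteq> I \<Longrightarrow>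
      (norm (\<Sum>k\<in>F. a k *\<^sub>C x k))\<^sup>2 \<le> B * (\<Sum>k\<in>F. (cmod (a k))\<^sup>2)"
    using bessel_onE[OF assms(1)] by blast
  then show ?thesis
    unfolding bessel_on_def using assms(2) by (intro exI[of _ B]) auto
qed

text \<open>Duality between synthesis and analysis: test the Bessel bound on the coefficients
  \<open>cinner y (x k)\<close> themselves. The resulting vector \<open>f\<close> pairs with
  \<open>y\<close> to give exactly the sum \<open>S\<close> to be bounded, so
  \<open>S * S \<le> (norm f)\<^sup>2 \<le> B * S\<close>, and a nonzero \<open>S\<close>
  cancels.\<close>

lemma bessel_on_sum_cinner_le:
  fixes x :: "nat \<Rightarrow> 'a::complex_inner"
  assumes "bessel_on I x"
  obtains B where "B > 0"
    and "\<And>F y. finite F \<Longrightarrow> F \<subseteq> I \<Longrightarrow> norm y = 1 \<Longrightarrow>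
      (\<Sum>k\<in>F. (cmod (cinner y (x k)))\<^sup>2) \<le> B"
proof -
  obtain B where "B > 0" and B: "\<And>F a. finite F \<Longrightarrow> F \<subseteq> I \<Longrightarrow>
      (norm (\<Sum>k\<in>F. a k *\<^sub>C x k))\<^sup>2 \<le> B * (\<Sum>k\<in>F. (cmod (a k))\<^sup>2)"
    using bessel_onE[OF assms] by blast
  show ?thesis
  proof (rule that[OF \<open>B > 0\<close>])
    fix F and y :: 'a
    assume F: "finite F" "F \<subseteq> I" and y: "norm y = 1"
    define f where "f = (\<Sum>k\<in>F. cinner y (x k) *\<^sub>C x k)"
    define S where "S = (\<Sum>k\<in>F. (cmod (cinner y (x k)))\<^sup>2)"
    have "S \<ge> 0"
      by (simp add: S_def sum_nonneg)
    have "cinner f y = (\<Sum>k\<in>F. cinner y (x k) * cnj (cinner y (x k)))"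
      unfolding f_def cinner_sum_left cinner_scaleC_left
      by (intro sum.cong refl arg_cong2[where f = times] cinner_commute)
    also have "\<dots> = complex_of_real S"
      by (simp only: S_def of_real_sum complex_norm_square)
    finally have "S \<le> norm f"
      using cmod_cinner_le_norm[OF y, of f] \<open>S \<ge> 0\<close> by simp
    then have "S * S \<le> (norm f)\<^sup>2"
      using \<open>S \<ge> 0\<close> by (simp add: power2_eq_square mult_mono)
    also have "\<dots> \<le> B * S"
      using B[OF F] by (simp add: f_def S_def)
    finally show "S \<le> B"
      using \<open>S \<ge> 0\<close> \<open>B > 0\<close> by (cases "S = 0") auto
  qed
qed

text \<open>Colour the naturals in increasing order: \<open>n\<close> only has to avoid the colours
  of its at most \<open>D\<close> smaller neighbours, and \<open>D + 1\<close> colours are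
  available.\<close>

lemma greedy_colouring:
  fixes E :: "nat \<Rightarrow> nat \<Rightarrow> bool"
  assumes "\<And>n. card {k. k < n \<and> E n k} \<le> D"
  obtains c :: "nat \<Rightarrow> nat"
  where "\<And>n. c n \<le> D" and "\<And>n k. k < n \<Longrightarrow> E n k \<Longrightarrow> c k \<noteq> c n"
proof -
  have "\<exists>c. \<forall>n. c n \<le> D \<and> (\<forall>k<n. E n k \<longrightarrow> c k \<noteq> c n)"
  \<comment> \<open>The condition on the colour of \<open>n\<close> looks only at colours below
    \<open>n\<close>, so recursion along the order builds \<open>c\<close>.\<close>
  proof (rule dependent_wellorder_choice)
    fix n and c :: "nat \<Rightarrow> nat"
    have "card (c ` {k. k < n \<and> E n k}) \<le> D"
      by (rule order_trans[OF card_image_le assms]) simp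
    then have "\<not> {..D} \<subseteq> c ` {k. k < n \<and> E n k}"
      using card_mono[of "c ` {k. k < n \<and> E n k}" "{..D}"] by auto
    then show "\<exists>r. r \<le> D \<and> (\<forall>k<n. E n k \<longrightarrow> c k \<noteq> r)"
      by blast
  qed auto
  then show ?thesis
    using that by blast
qed

theorem theorem2p2:
  fixes x :: "nat \<Rightarrow> 'a::complex_hilbert"
  assumes "bessel_on {1..} x"
    and "\<And>n. n \<ge> 1 \<Longrightarrow> norm (x n) = 1"
  shows "\<exists>(r::nat) (I :: nat \<Rightarrow> nat set).
    (\<Union>j\<in>{1..r}. I j) = {1..} \<and> disjoint_family_on I {1..r} \<and>
    (\<forall>j\<in>{1..r}. separated_on (I j) x \<and> bessel_on (I j) x)"
proof -
  obtain B where "B > 0" and B: "\<And>F y. finite F \<Longrightarrow> F \<subseteq> {1..} \<Longrightarrow> norm y = 1 \<Longrightarrow>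
      (\<Sum>k\<in>F. (cmod (cinner y (x k)))\<^sup>2) \<le> B"
    using bessel_on_sum_cinner_le[OF assms(1)] by blast
  \<comment> \<open>Index 0 lies outside the family and \<open>x 0\<close> is arbitrary, so 0 is
    kept isolated in the graph.\<close>
  define E where "E n k \<longleftrightarrow> 1 \<le> k \<and> 1 \<le> n \<and> cmod (cinner (x n) (x k)) > 1/2" for n k
  define D where "D = nat \<lfloor>4 * B\<rfloor>"
  have "card {k. k < n \<and> E n k} \<le> D" for n
  proof (cases "n \<ge> 1")
    case True
    let ?F = "{k. k < n \<and> E n k}"
    \<comment> \<open>Each neighbour contributes more than 1/4 to a sum bounded by \<open>B\<close>;
      this is the source of the 4 in \<open>D\<close>.\<close>
    have "real (card ?F) * (1/2)\<^sup>2 = (\<Sum>k\<in>?F. (1/2)\<^sup>2)"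
      by simp
    also have "\<dots> \<le> (\<Sum>k\<in>?F. (cmod (cinner (x n) (x k)))\<^sup>2)"
      by (intro sum_mono power_mono) (auto simp: E_def)
    also have "\<dots> \<le> B"
      by (intro B assms(2) True) (auto simp: E_def)
    finally have "real (card ?F) \<le> 4 * B"
      by (simp add: power2_eq_square)
    then show ?thesis
      unfolding D_def by (simp add: le_nat_floor)
  next
    case False
    then show ?thesis
      by (simp add: E_def)
  qed
  then obtain c where c_le: "\<And>n. c n \<le> D"
    and c_neq: "\<And>n k. k < n \<Longrightarrow> E n k \<Longrightarrow> c k \<noteq> c n"
    using greedy_colouring by blast
  define I where "I j = {n. 1 \<le> n \<and> Suc (c n) = j}" for j
  have sep: "cmod (cinner (x n) (x k)) \<le> 1/2" if "n \<in> I j" "k \<in> I j" "n \<noteq> k" for j n k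
  proof -
    \<comment> \<open>The colouring only separates \<open>n\<close> from smaller neighbours;
      symmetry of the modulus covers both orders of \<open>n\<close> and \<open>k\<close>.\<close>
    have "cmod (cinner (x k) (x n)) = cmod (cinner (x n) (x k))"
      by (metis cinner_commute complex_mod_cnj)
    then show ?thesis
      using that c_neq[of k n] c_neq[of n k]
      by (cases n k rule: linorder_cases) (force simp: I_def E_def)+
  qed
  have "(\<Union>j\<in>{1..Suc D}. I j) = {1..}"
    using c_le by (auto simp: I_def)
  moreover have "disjoint_family_on I {1..Suc D}"
    by (auto simp: disjoint_family_on_def I_def)
  moreover have "separated_on (I j) x" for j
    unfolding separated_on_def
  proof (intro conjI exI[of _ "1/2"])
    show "\<forall>n\<in>I j. norm (x n) = 1"
      using assms(2) by (simp add: I_def)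
  qed (use sep in auto)
  moreover have "bessel_on (I j) x" for j
    by (rule bessel_on_subset[OF assms(1)]) (auto simp: I_def)
  ultimately show ?thesis
    by blast
qed

end
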